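(* Let $N\geq 1$ be an integer and let $f\in C^1(\mathbb{R})$. Then the equation $-\Delta u=f(u)$ in $\mathbb{R}^N$ has no nonconstant bounded radial global minimizers.
   Context: Let $G:\mathbb{R}\to\mathbb{R}$ be a primitive of $-f$, i.e. $G'=-f$ (the choice of additive constant is immaterial for the definition below). For a bounded domain $\Omega\subset\mathbb{R}^N$, the energy functional is $$E_\Omega(u)=\int_\Omega\left(\tfrac12|\nabla u|^2+G(u)\right)dx .$$ A function $u\in C^1(\mathbb{R}^N)$ is called a global minimizer of $-\Delta u=f(u)$ in $\mathbb{R}^N$ if for every smooth bounded domain $\Omega\subset\mathbb{R}^N$ one has $E_\Omega(u)\leq E_\Omega(w)$ for every function $w\in C^{0,1}(\overline{\Omega})$ (Lipschitz on $\overline\Omega$) such that $w=u$ on $\partial\Omega$. A function $u$ on $\mathbb{R}^N$ is radial if $u(x)$ depends only on $|x|$. *)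

theory Defs
  imports "HOL-Analysis.Analysis"
begin

text \<open>At a point where \<^term>\<open>u\<close> is not differentiable the value is unspecified. For Lipschitz
  functions this concerns only a null set (Rademacher), on which the energy below does not depend.\<close>

definition grad :: "('a::euclidean_space \<Rightarrow> real) \<Rightarrow> 'a \<Rightarrow> 'a" where
  "grad u x = (THE D. GDERIV u x :> D)"

lemma grad_eqI:
  assumes "GDERIV u x :> D"
  shows "grad u x = D"
  unfolding grad_def
proof (rule the_equality)
  fix D' assume "GDERIV u x :> D'"
  then have "(\<lambda>h. inner h D') = (\<lambda>h. inner h D)"
    using assms unfolding gderiv_def by (rule has_derivative_unique)
  then show "D' = D"
    by (metis inner_commute vector_eq_rdot)
qed (rule assms)

text \<open>The class $C^k(S)$, meant for open \<^term>\<open>S\<close>.\<close>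

fun C_k_on :: "nat \<Rightarrow> ('a::euclidean_space \<Rightarrow> real) \<Rightarrow> 'a set \<Rightarrow> bool" where
  "C_k_on 0 u S \<longleftrightarrow> continuous_on S u"
| "C_k_on (Suc k) u S \<longleftrightarrow>
     (\<forall>x\<in>S. u differentiable (at x)) \<and>
     (\<forall>b\<in>Basis. C_k_on k (\<lambda>x. frechet_derivative u (at x) b) S)"

definition smooth_fun_on :: "('a::euclidean_space \<Rightarrow> real) \<Rightarrow> 'a set \<Rightarrow> bool" where
  "smooth_fun_on u S \<longleftrightarrow> (\<forall>k. C_k_on k u S)"

text \<open>The boundary is smooth if \<^term>\<open>\<Omega>\<close> is, near each boundary point, the strict sublevel set of a
  smooth function with nonvanishing gradient; in particular \<^term>\<open>\<Omega>\<close> lies locally on one side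
  of its boundary.\<close>

definition smooth_bounded_domain :: "'a::euclidean_space set \<Rightarrow> bool" where
  "smooth_bounded_domain \<Omega> \<longleftrightarrow>
     open \<Omega> \<and> connected \<Omega> \<and> \<Omega> \<noteq> {} \<and> bounded \<Omega> \<and>
     (\<forall>p\<in>frontier \<Omega>. \<exists>U \<phi>. open U \<and> p \<in> U \<and> smooth_fun_on \<phi> U \<and> grad \<phi> p \<noteq> 0 \<and>
        \<Omega> \<inter> U = {x \<in> U. \<phi> x < 0})"

definition energy :: "(real \<Rightarrow> real) \<Rightarrow> 'a::euclidean_space set \<Rightarrow> ('a \<Rightarrow> real) \<Rightarrow> real" where
  "energy G \<Omega> u = (LINT x:\<Omega>|lebesgue. (norm (grad u x))\<^sup>2 / 2 + G (u x))"

text \<open>A function on the closure of \<^term>\<open>\<Omega>\<close> is represented by a total function \<^term>\<open>w\<close>; its values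
  elsewhere play no role, since \<^term>\<open>\<Omega>\<close> is open. Primitives of a continuous
  \<^term>\<open>f\<close> exist and differ by constants, which do not affect the comparison
  of energies, so here ``some primitive'' amounts to ``every primitive''.\<close>

definition global_minimizer :: "(real \<Rightarrow> real) \<Rightarrow> ('a::euclidean_space \<Rightarrow> real) \<Rightarrow> bool" where
  "global_minimizer f u \<longleftrightarrow>
     C_k_on 1 u UNIV \<and>
     (\<exists>G. (\<forall>t. (G has_real_derivative - f t) (at t)) \<and>
        (\<forall>\<Omega>. smooth_bounded_domain \<Omega> \<longrightarrow>
          (\<forall>w. (\<exists>L. L-lipschitz_on (closure \<Omega>) w) \<and> (\<forall>x\<in>frontier \<Omega>. w x = u x) \<longrightarrow>
             energy G \<Omega> u \<le> energy G \<Omega> w)))"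

definition radial :: "('a::euclidean_space \<Rightarrow> real) \<Rightarrow> bool" where
  "radial u \<longleftrightarrow> (\<forall>x y. norm x = norm y \<longrightarrow> u x = u y)"

end

theory Submission
  imports Defs
begin

text \<open>
  Write $u(x) = v(|x|)$ and $n$ for the dimension. In the volume variable $t = |x|^n$ Lebesgue measure
  becomes a multiple of Lebesgue measure on $[0,\infty)$, so translations in $t$ are volume preserving
  rearrangements of radial functions. Comparing $u$ on $B_R$ with the competitor that has the core
  $|x|^n < d$ cut out, the remaining profile moved inwards by $d$ in the variable $t$, and the constant
  $v(R)$ put into the outer shell, one finds that the energy of $u$ on the core is at most the volume of
  the core times $G(v(R))$. Comparison with functions that are constant up to a boundary layer shows that
  $G(v(R))$ comes arbitrarily close to $\inf G(u)$ for large $R$. Hence the gradient part of the energy on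
  the core vanishes, for every $d$.
\<close>

section \<open>Balls as admissible domains\<close>

lemma C_k_on_const: "C_k_on k (\<lambda>x. c) S"
  by (induction k arbitrary: c) (simp_all add: frechet_derivative_const)

lemma C_k_on_inner: "C_k_on k (\<lambda>x. c * (x \<bullet> b)) S"
proof (cases k)
  case 0
  then show ?thesis by (simp add: continuous_intros)
next
  case (Suc m)
  have D: "((\<lambda>x. c * (x \<bullet> b)) has_derivative (\<lambda>h. c * (h \<bullet> b))) (at x)" for x
    by (auto intro!: derivative_eq_intros)
  then show ?thesis
    using Suc frechet_derivative_at[OF D, symmetric] C_k_on_const
    by (auto simp: differentiable_def)
qed

text \<open>The squared norm, unlike the norm, is also smooth at the origin, so it serves as a
  defining function of a ball on the whole space.\<close>

lemma smooth_fun_on_sphere_equation: "smooth_fun_on (\<lambda>x. x \<bullet> x - r) S"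
  unfolding smooth_fun_on_def
proof
  fix k
  show "C_k_on k (\<lambda>x::'a. x \<bullet> x - r) S"
  proof (cases k)
    case 0
    then show ?thesis by (simp add: continuous_intros)
  next
    case (Suc m)
    have D: "((\<lambda>x::'a. x \<bullet> x - r) has_derivative (\<lambda>h. 2 * (x \<bullet> h))) (at x)" for x
      by (auto intro!: derivative_eq_intros simp: inner_commute)
    then show ?thesis
      using Suc frechet_derivative_at[OF D, symmetric] C_k_on_inner[of m 2]
      by (auto simp: differentiable_def)
  qed
qed

lemma smooth_bounded_domain_ball:
  assumes "0 < R"
  shows "smooth_bounded_domain (ball (0 :: 'a::euclidean_space) R)"
  unfolding smooth_bounded_domain_def
proof (intro conjI ballI)
  fix p :: 'a
  assume "p \<in> frontier (ball 0 R)"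
  then have p: "norm p = R"
    using assms by (simp add: frontier_ball)
  let ?\<phi> = "\<lambda>x::'a. x \<bullet> x - R\<^sup>2"
  have "GDERIV ?\<phi> p :> 2 *\<^sub>R p"
    unfolding gderiv_def by (auto intro!: derivative_eq_intros simp: inner_commute)
  then have "grad ?\<phi> p \<noteq> 0"
    using p assms by (auto simp: grad_eqI)
  moreover have "ball 0 R \<inter> UNIV = {x \<in> UNIV. ?\<phi> x < 0}"
    using assms abs_le_square_iff[of R] by (fastforce simp flip: power2_norm_eq_inner not_le)
  ultimately show "\<exists>U \<phi>. open U \<and> p \<in> U \<and> smooth_fun_on \<phi> U \<and> grad \<phi> p \<noteq> 0 \<and>
      ball 0 R \<inter> U = {x \<in> U. \<phi> x < 0}"
    using smooth_fun_on_sphere_equation by blast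
qed (use assms in auto)

section \<open>Integration of radial functions in the volume variable\<close>

text \<open>A ball of radius \<open>s\<close> has volume \<open>unit_ball_vol n * s ^ n\<close>, so
  in the variable \<open>norm x ^ n\<close> volume grows at a constant rate. Both measures are
  compared on the half-lines \<open>{a<..}\<close>, which determine them since all values are
  finite.\<close>

lemma distr_norm_power:
  fixes R :: real
  assumes "0 < R"
  defines "n \<equiv> DIM('a::euclidean_space)"
  shows "distr (density lborel (indicator (ball (0::'a) R))) borel (\<lambda>x. norm x ^ n)
       = density lborel (\<lambda>t. ennreal (unit_ball_vol n) * indicator {0<..<R ^ n} t)"
    (is "?M = ?N")
proof (rule measure_eqI_lessThan)
  have n: "0 < n" by (simp add: n_def)
  have MN: "emeasure ?M {a<..} = emeasure ?N {a<..} \<and> emeasure ?M {a<..} < \<infinity>" for a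
  proof -
    \<comment> \<open>Clamping \<open>a\<close> to the range of \<open>norm x ^ n\<close> does not
      change the mass beyond it; \<open>s\<close> is the radius at which the value \<open>b\<close>
      is attained.\<close>
    define b where "b = min (max a 0) (R ^ n)"
    define s where "s = root n b"
    have b: "0 \<le> b" "b \<le> R ^ n"
      using assms by (auto simp: b_def)
    have s: "0 \<le> s" "s ^ n = b" "s \<le> R"
      using n b assms(1) real_root_le_mono[OF n b(2)] by (auto simp: s_def real_root_power_cancel)
    \<comment> \<open>For \<open>a < 0\<close> the centre lies beyond \<open>a\<close> too, although
      \<open>s = 0\<close> there. This point is later discarded as a null set.\<close>
    have ba: "a < r ^ n \<longleftrightarrow> s < r \<or> a < 0" if "0 \<le> r" "r < R" for r
    proof -
      have "r ^ n < R ^ n"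
        using that n by (intro power_strict_mono) auto
      moreover have "s < r \<longleftrightarrow> b < r ^ n"
        using power_mono_iff[OF that(1) s(1) n] s(2) by linarith
      moreover have "0 \<le> r ^ n" using that by simp
      ultimately show ?thesis
        unfolding b_def by linarith
    qed
    have "emeasure ?M {a<..} = emeasure (density lborel (indicator (ball (0::'a) R))) {x. a < norm x ^ n}"
      by (simp add: emeasure_distr vimage_def)
    also have "\<dots> = (\<integral>\<^sup>+x. indicator (ball (0::'a) R) x * indicator {x. a < norm x ^ n} x \<partial>lborel)"
      by (rule emeasure_density) (auto intro!: borel_measurable_indicator)
    also have "\<dots> = (\<integral>\<^sup>+x. indicator ({x. a < norm x ^ n} \<inter> ball (0::'a) R) x \<partial>lborel)"
      by (intro nn_integral_cong) (simp add: indicator_inter_arith mult.commute)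
    also have "\<dots> = emeasure lborel ({x. a < norm x ^ n} \<inter> ball (0::'a) R)"
      by (rule nn_integral_indicator) simp
    also have "\<dots> = emeasure lborel (ball (0::'a) R - cball 0 s)"
    proof (cases "a < 0")
      case True
      then have "{x::'a. a < norm x ^ n} \<inter> ball 0 R = ball 0 R"
        using order_less_le_trans[OF True] by auto
      moreover have "s = 0" using True assms n by (simp add: s_def b_def)
      moreover have "emeasure lborel (ball (0::'a) R - {0}) = emeasure lborel (ball (0::'a) R)"
        by (rule emeasure_Diff_null_set) (auto intro!: null_setsI)
      ultimately show ?thesis by simp
    next
      case False
      then have "{x::'a. a < norm x ^ n} \<inter> ball 0 R = ball 0 R - cball 0 s"
        using ba by auto
      then show ?thesis by simp
    qed
    also have "\<dots> = emeasure lborel (ball (0::'a) R) - emeasure lborel (cball (0::'a) s)"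
    proof (cases "s = R")
      case True
      \<comment> \<open>Here the closed ball is not contained in the open one, so the subtraction
        rule does not apply; both sides are 0.\<close>
      then have empty: "ball (0::'a) R - cball 0 s = {}" by auto
      show ?thesis
        unfolding empty using True by (simp add: emeasure_ball emeasure_cball assms(1) less_imp_le)
    next
      case False
      then show ?thesis using s
        by (intro emeasure_Diff) (auto simp: emeasure_cball)
    qed
    also have "\<dots> = ennreal (unit_ball_vol n * (R ^ n - b))"
      using assms(1) s(1,3) b(1) by (simp add: emeasure_ball emeasure_cball ennreal_minus
        s(2) right_diff_distrib flip: n_def)
    finally have M: "emeasure ?M {a<..} = ennreal (unit_ball_vol n * (R ^ n - b))" .
    have "emeasure ?N {a<..} = (\<integral>\<^sup>+t. ennreal (unit_ball_vol n) * indicator ({0<..<R ^ n} \<inter> {a<..}) t \<partial>lborel)"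
      by (subst emeasure_density) (auto intro!: nn_integral_cong simp: indicator_def)
    also have "{0<..<R ^ n} \<inter> {a<..} = {b<..<R ^ n}"
      using assms(1) by (auto simp: b_def)
    also have "(\<integral>\<^sup>+t. ennreal (unit_ball_vol n) * indicator {b<..<R ^ n} t \<partial>lborel)
        = ennreal (unit_ball_vol n * (R ^ n - b))"
      using b by (simp add: nn_integral_cmult_indicator ennreal_mult)
    finally show ?thesis using M by simp
  qed
  show "emeasure ?M {a<..} < \<infinity>" "emeasure ?M {a<..} = emeasure ?N {a<..}" for a
    using MN[of a] by blast+
qed auto


text \<open>The change of variables that belongs to \<open>distr_norm_power\<close>. It is carried
  out over \<open>lborel\<close>; since \<open>h\<close> is Borel, passing to the completion changes
  neither integrability nor the integral.\<close>

lemma integral_ball_norm_power: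
  fixes h :: "real \<Rightarrow> real"
  defines "n \<equiv> DIM('a::euclidean_space)"
  assumes "0 < R" and h [measurable]: "h \<in> borel_measurable borel"
    and int: "set_integrable lborel {0<..<R ^ n} h"
  shows "set_integrable lebesgue (ball (0::'a) R) (\<lambda>x. h (norm x ^ n))"
    and "(LINT x:ball (0::'a) R|lebesgue. h (norm x ^ n))
       = unit_ball_vol n * (LINT t:{0<..<R ^ n}|lborel. h t)"
proof -
  define c where "c = unit_ball_vol n"
  have c: "0 \<le> c" by (simp add: c_def)
  let ?D = "density lborel (indicator (ball (0::'a) R))"
  have D: "?D = density lborel (\<lambda>x. ennreal (indicator (ball (0::'a) R) x))"
    by (simp add: ennreal_indicator)
  have E: "density lborel (\<lambda>t. ennreal c * indicator {0<..<R ^ n} t)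
      = density lborel (\<lambda>t. ennreal (c * indicator {0<..<R ^ n} t))"
    using c by (intro density_cong) (auto simp: indicator_def)
  have distr: "distr ?D borel (\<lambda>x. norm x ^ n)
      = density lborel (\<lambda>t. ennreal (c * indicator {0<..<R ^ n} t))"
    using distr_norm_power[OF \<open>0 < R\<close>, where 'a='a] E by (simp add: n_def c_def)
  have "integrable (density lborel (\<lambda>t. ennreal (c * indicator {0<..<R ^ n} t))) h"
    using int c
    by (subst integrable_density) (auto simp: set_integrable_def mult.assoc)
  then have 1: "integrable ?D (\<lambda>x. h (norm x ^ n))"
    by (subst (asm) distr[symmetric], subst (asm) integrable_distr_eq) auto
  have 2: "integral\<^sup>L ?D (\<lambda>x. h (norm x ^ n)) = c * (LINT t:{0<..<R ^ n}|lborel. h t)"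
  proof -
    have "integral\<^sup>L ?D (\<lambda>x. h (norm x ^ n))
        = integral\<^sup>L (density lborel (\<lambda>t. ennreal (c * indicator {0<..<R ^ n} t))) h"
      unfolding distr[symmetric] by (subst integral_distr) auto
    also have "\<dots> = c * (LINT t:{0<..<R ^ n}|lborel. h t)"
      using c by (subst integral_density) (auto simp: set_lebesgue_integral_def mult.assoc)
    finally show ?thesis .
  qed
  have I: "integrable lborel (\<lambda>x. indicator (ball (0::'a) R) x *\<^sub>R h (norm x ^ n))"
    using 1 unfolding D
    by (subst (asm) integrable_density) (auto intro!: borel_measurable_indicator)
  then show "set_integrable lebesgue (ball (0::'a) R) (\<lambda>x. h (norm x ^ n))"
    unfolding set_integrable_def
    by (subst integrable_completion) auto
  have "(LINT x:ball (0::'a) R|lebesgue. h (norm x ^ n)) = (LINT x:ball (0::'a) R|lborel. h (norm x ^ n))"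
    unfolding set_lebesgue_integral_def by (rule integral_completion[OF borel_measurable_integrable[OF I]])
  also have "\<dots> = integral\<^sup>L ?D (\<lambda>x. h (norm x ^ n))"
    unfolding D set_lebesgue_integral_def by (subst integral_density) (auto intro!: borel_measurable_indicator)
  finally show "(LINT x:ball (0::'a) R|lebesgue. h (norm x ^ n))
       = unit_ball_vol n * (LINT t:{0<..<R ^ n}|lborel. h t)"
    using 2 by (simp add: c_def)
qed

section \<open>Energy of radial functions\<close>

text \<open>Chain rule: away from the origin the gradient of the norm is a unit vector.\<close>

lemma norm_grad_radial:
  fixes x :: "'a::euclidean_space"
  assumes "(q has_real_derivative d) (at (norm x))" and "x \<noteq> 0"
  shows "norm (grad (\<lambda>x. q (norm x)) x) = \<bar>d\<bar>"
  using GDERIV_DERIV_compose[OF GDERIV_norm[OF assms(2)] assms(1)] assms(2)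
  by (simp add: grad_eqI norm_sgn)

text \<open>The competitors have a kink at one radius \<open>s\<close>. The energy density is
  therefore given in the volume variable by two functions, each continuous up to the ends of its
  interval, so that integrability is automatic.\<close>

lemma energy_radial:
  fixes q p h\<^sub>1 h\<^sub>2 G :: "real \<Rightarrow> real"
  defines "n \<equiv> DIM('a::euclidean_space)"
  assumes s: "0 < s" "s \<le> R"
    and q: "\<And>r. 0 < r \<Longrightarrow> r < R \<Longrightarrow> r \<noteq> s \<Longrightarrow> (q has_real_derivative p r) (at r)"
    and h\<^sub>1: "continuous_on {0..s ^ n} h\<^sub>1"
      "\<And>r. 0 < r \<Longrightarrow> r < s \<Longrightarrow> h\<^sub>1 (r ^ n) = (p r)\<^sup>2 / 2 + G (q r)"
    and h\<^sub>2: "continuous_on {s ^ n..R ^ n} h\<^sub>2"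
      "\<And>r. s < r \<Longrightarrow> r < R \<Longrightarrow> h\<^sub>2 (r ^ n) = (p r)\<^sup>2 / 2 + G (q r)"
  shows "energy G (ball (0::'a) R) (\<lambda>x. q (norm x))
    = unit_ball_vol n * (integral {0..s ^ n} h\<^sub>1 + integral {s ^ n..R ^ n} h\<^sub>2)"
proof -
  have n: "0 < n" by (simp add: n_def)
  have R: "0 < R" using s by simp
  have sR: "s ^ n \<le> R ^ n" "0 < s ^ n" using s by (auto intro: power_mono)
  \<comment> \<open>The second interval is half-open so that the value at \<open>s ^ n\<close> is
    not counted twice.\<close>
  define h where "h = (\<lambda>t. indicator {0..s ^ n} t * h\<^sub>1 t + indicator {s ^ n<..R ^ n} t * h\<^sub>2 t)"
  have i1: "set_integrable lborel {0..s ^ n} h\<^sub>1" and i2: "set_integrable lborel {s ^ n..R ^ n} h\<^sub>2"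
    using h\<^sub>1(1) h\<^sub>2(1) by (auto intro: borel_integrable_atLeastAtMost')
  have i2': "set_integrable lborel {s ^ n<..R ^ n} h\<^sub>2"
    by (rule set_integrable_subset[OF i2]) auto
  have hint: "integrable lborel h"
    using i1 i2' unfolding h_def set_integrable_def by simp
  have hm: "h \<in> borel_measurable borel"
    using borel_measurable_integrable[OF hint] by simp
  have "set_integrable lborel {0<..<R ^ n} h"
    unfolding set_integrable_def using hint by (intro integrable_mult_indicator) auto
  note H = integral_ball_norm_power[OF R hm this[unfolded n_def]]
  have "(LINT t:{0<..<R ^ n}|lborel. h t) = (LINT t|lborel. h t)"
    unfolding set_lebesgue_integral_def
  proof (rule integral_cong_AE)
    have "AE t in lborel. t \<noteq> 0 \<and> t \<noteq> R ^ n"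
      using AE_lborel_singleton[of 0] AE_lborel_singleton[of "R ^ n"] by eventually_elim auto
    then show "AE t in lborel. indicator {0<..<R ^ n} t *\<^sub>R h t = h t"
      by eventually_elim (use sR in \<open>auto simp: h_def indicator_def\<close>)
  qed (use hm in auto)
  also have "\<dots> = (LINT t:{0..s ^ n}|lborel. h\<^sub>1 t) + (LINT t:{s ^ n<..R ^ n}|lborel. h\<^sub>2 t)"
    using i1 i2' unfolding h_def set_integrable_def set_lebesgue_integral_def by simp
  also have "(LINT t:{s ^ n<..R ^ n}|lborel. h\<^sub>2 t) = (LINT t:{s ^ n..R ^ n}|lborel. h\<^sub>2 t)"
    unfolding set_lebesgue_integral_def
  proof (rule integral_cong_AE)
    show "AE t in lborel. indicator {s ^ n<..R ^ n} t *\<^sub>R h\<^sub>2 t = indicator {s ^ n..R ^ n} t *\<^sub>R h\<^sub>2 t"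
      using AE_lborel_singleton[of "s ^ n"] by eventually_elim (auto simp: indicator_def)
  qed (use i2 i2' in \<open>auto simp: set_integrable_def dest: borel_measurable_integrable\<close>)
  finally have L: "(LINT t:{0<..<R ^ n}|lborel. h t) = integral {0..s ^ n} h\<^sub>1 + integral {s ^ n..R ^ n} h\<^sub>2"
    using i1 i2 by (simp add: set_borel_integral_eq_integral)
  let ?F = "\<lambda>x::'a. (norm (grad (\<lambda>x. q (norm x)) x))\<^sup>2 / 2 + G (q (norm x))"
  \<comment> \<open>The norm is not differentiable at the origin, and \<open>q\<close> may have its
    kink on the sphere of radius \<open>s\<close>.\<close>
  have N: "negligible (insert 0 (sphere (0::'a) s))"
    by (simp add: negligible_sphere)
  have eq: "?F x = h (norm x ^ n)" if "x \<in> ball 0 R - insert 0 (sphere (0::'a) s)" for x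
  proof -
    have x: "0 < norm x" "norm x < R" "norm x \<noteq> s" "x \<noteq> 0"
      using that by auto
    have "?F x = (p (norm x))\<^sup>2 / 2 + G (q (norm x))"
      using norm_grad_radial[OF q[OF x(1-3)] x(4)] by simp
    also have "\<dots> = h (norm x ^ n)"
    proof (cases "norm x < s")
      case True
      then have "norm x ^ n < s ^ n" using n by (intro power_strict_mono) auto
      then show ?thesis using h\<^sub>1(2)[OF x(1) True] by (simp add: h_def)
    next
      case False
      then have "s < norm x" using x by simp
      moreover from this have "s ^ n < norm x ^ n" using n s by (intro power_strict_mono) auto
      moreover have "norm x ^ n \<le> R ^ n" using x by (intro power_mono) auto
      ultimately show ?thesis using h\<^sub>2(2)[of "norm x"] x by (simp add: h_def)
    qed
    finally show ?thesis .
  qed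
  have "set_integrable lebesgue (ball 0 R) ?F"
    by (rule absolutely_integrable_spike[OF H(1) N]) (simp add: eq n_def)
  then have "energy G (ball (0::'a) R) (\<lambda>x. q (norm x)) = integral (ball 0 R) ?F"
    unfolding energy_def by (rule set_lebesgue_integral_eq_integral)
  also have "\<dots> = integral (ball (0::'a) R) (\<lambda>x. h (norm x ^ n))"
    by (rule integral_spike[OF N]) (rule eq[symmetric])
  also have "\<dots> = (LINT x:ball (0::'a) R|lebesgue. h (norm x ^ n))"
    using set_lebesgue_integral_eq_integral(2)[OF H(1)] by (simp add: n_def)
  also have "\<dots> = unit_ball_vol n * (LINT t:{0<..<R ^ n}|lborel. h t)"
    using H(2) by (simp add: n_def)
  finally show ?thesis using L by simp
qed

section \<open>Reduction to one dimension\<close>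

text \<open>The profile \<open>v\<close> is thought of as the restriction of \<open>u\<close> to a
  full line through the origin, hence differentiable on all of the real line, with an ordinary
  derivative at 0. Minimality is tested on balls about the origin.\<close>

locale radial_minimizer =
  fixes u :: "'a::euclidean_space \<Rightarrow> real" and v v' G :: "real \<Rightarrow> real" and M :: real and n :: nat
  assumes n_def: "n = DIM('a)"
    and u: "u = (\<lambda>x. v (norm x))"
    and v: "(v has_real_derivative v' r) (at r)"
    and v'_cont: "continuous_on UNIV v'"
    and v_bound: "\<bar>v r\<bar> \<le> M"
    and G_cont: "continuous_on UNIV G"
    and minimal: "0 < R \<Longrightarrow> L-lipschitz_on (cball 0 R) w \<Longrightarrow> (\<And>x. norm x = R \<Longrightarrow> w x = u x)
      \<Longrightarrow> energy G (ball 0 R) u \<le> energy G (ball 0 R) w"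
begin

lemma n_pos [simp]: "0 < n" "n \<noteq> 0"
  by (auto simp: n_def)

text \<open>The energy density of \<^term>\<open>u\<close> as a function of the volume variable $t = |x|^n$.\<close>

definition dens :: "real \<Rightarrow> real" where
  "dens t = (v' (root n t))\<^sup>2 / 2 + G (v (root n t))"

lemma v_cont: "continuous_on S v"
  using v by (meson DERIV_isCont continuous_at_imp_continuous_on)

lemma continuous_v [continuous_intros]: "continuous_on S g \<Longrightarrow> continuous_on S (\<lambda>t. v (g t))"
  using continuous_on_compose2[OF v_cont[of UNIV]] by auto

lemma continuous_v' [continuous_intros]: "continuous_on S g \<Longrightarrow> continuous_on S (\<lambda>t. v' (g t))"
  using continuous_on_compose2[OF v'_cont] by auto

lemma continuous_G [continuous_intros]: "continuous_on S g \<Longrightarrow> continuous_on S (\<lambda>t. G (g t))"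
  using continuous_on_compose2[OF G_cont] by auto

lemma dens_cont: "continuous_on S dens"
  unfolding dens_def by (intro continuous_intros) auto

lemma dens_integrable: "dens integrable_on {a..b}"
  by (rule integrable_continuous_interval[OF dens_cont])

text \<open>Minimality tested with \<open>q (norm x)\<close>, which is Lipschitz because the norm is
  nonexpanding. Both energies carry the positive factor \<open>unit_ball_vol n\<close>, which
  cancels.\<close>

lemma integral_dens_le:
  assumes s: "0 < s" "s \<le> R"
    and lip: "L-lipschitz_on {0..R} q" and qR: "q R = v R"
    and q: "\<And>r. 0 < r \<Longrightarrow> r < R \<Longrightarrow> r \<noteq> s \<Longrightarrow> (q has_real_derivative p r) (at r)"
    and h\<^sub>1: "continuous_on {0..s ^ n} h\<^sub>1"
      "\<And>r. 0 < r \<Longrightarrow> r < s \<Longrightarrow> h\<^sub>1 (r ^ n) = (p r)\<^sup>2 / 2 + G (q r)"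
    and h\<^sub>2: "continuous_on {s ^ n..R ^ n} h\<^sub>2"
      "\<And>r. s < r \<Longrightarrow> r < R \<Longrightarrow> h\<^sub>2 (r ^ n) = (p r)\<^sup>2 / 2 + G (q r)"
  shows "integral {0..R ^ n} dens \<le> integral {0..s ^ n} h\<^sub>1 + integral {s ^ n..R ^ n} h\<^sub>2"
proof -
  have R: "0 < R" using s by simp
  have "1-lipschitz_on (cball (0::'a) R) norm"
    by (auto intro!: lipschitz_onI simp: dist_norm norm_triangle_ineq3)
  moreover have "norm ` cball (0::'a) R \<subseteq> {0..R}" by auto
  ultimately have "(L * 1)-lipschitz_on (cball (0::'a) R) (\<lambda>x. q (norm x))"
    by (intro lipschitz_on_compose2 lipschitz_on_subset[OF lip]) auto
  then have "energy G (ball 0 R) u \<le> energy G (ball (0::'a) R) (\<lambda>x. q (norm x))"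
    using qR by (intro minimal[OF R]) (auto simp: u)
  also have "\<dots> = unit_ball_vol n * (integral {0..s ^ n} h\<^sub>1 + integral {s ^ n..R ^ n} h\<^sub>2)"
    unfolding n_def by (rule energy_radial[where p=p]) (use assms in \<open>auto simp: n_def\<close>)
  \<comment> \<open>The profile of \<open>u\<close> has no kink, so \<open>s = R\<close> is taken
    and the second interval degenerates.\<close>
  also have "energy G (ball 0 R) u
      = unit_ball_vol n * (integral {0..R ^ n} dens + integral {R ^ n..R ^ n} dens)"
    unfolding u n_def
    by (intro energy_radial[where p=v'])
      (use R v dens_cont in \<open>auto simp: dens_def[abs_def] real_root_power_cancel simp flip: n_def\<close>)
  finally show ?thesis
    by simp
qed

section \<open>The potential along \<open>u\<close> far out\<close>

text \<open>Otherwise replacing \<^term>\<open>u\<close> by the constant \<^term>\<open>k\<close> away from the boundary of a large ball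
  saves an energy proportional to the volume of the ball, while the transition layer of width 1
  costs only a multiple of its surface.\<close>

lemma potential_dips:
  assumes "0 < \<epsilon>" "\<bar>k\<bar> \<le> M"
  shows "\<exists>r\<ge>r\<^sub>0. G (v r) < G k + \<epsilon>"
proof (rule ccontr)
  assume "\<not> ?thesis"
  then have ge: "G k + \<epsilon> \<le> G (v r)" if "r\<^sub>0 \<le> r" for r
    using that by (meson not_le)
  define r\<^sub>1 where "r\<^sub>1 = max r\<^sub>0 0"
  \<comment> \<open>The volume variable of the region on which only the crude bound
    \<open>- B\<close> is available from below.\<close>
  define a where "a = r\<^sub>1 ^ n"
  have "bounded (G ` {-M..M})"
    by (intro compact_imp_bounded compact_continuous_image continuous_on_subset[OF G_cont]) auto
  then obtain B where B: "\<bar>G y\<bar> \<le> B" if "\<bar>y\<bar> \<le> M" for y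
    by (fastforce simp: bounded_iff abs_le_iff)
  \<comment> \<open>Bound for the energy density in the transition layer: the slope there is at most
    \<open>2 * M\<close> in modulus and the values stay in \<open>{-M..M}\<close>.\<close>
  define C where "C = (2 * M)\<^sup>2 / 2 + B"
  \<comment> \<open>Lower bounds for \<open>dens\<close>, namely \<open>- B\<close> up to
    \<open>a\<close> and \<open>G k + \<epsilon>\<close> beyond it, are played against the
    competitor, which costs \<open>G k\<close> inside radius \<open>R - 1\<close> and at most
    \<open>C\<close> in the layer.\<close>
  have main: "\<epsilon> * R ^ n \<le> a * (G k + \<epsilon> + B) + (R ^ n - (R - 1) ^ n) * (C - G k)"
    if R: "1 + r\<^sub>1 < R" for R
  proof -
    have r1: "0 \<le> r\<^sub>1" "0 \<le> a" by (auto simp: r\<^sub>1_def a_def)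
    have R1: "0 < R - 1" "R - 1 \<le> R" using R r1 by auto
    define S where "S = R ^ n"
    define s where "s = (R - 1) ^ n"
    have sS: "0 \<le> s" "s \<le> S" using R1 by (auto simp: s_def S_def intro: power_mono)
    have aS: "a \<le> S" using R r1 by (auto simp: a_def S_def intro: power_mono)
    \<comment> \<open>The constant \<open>k\<close> up to radius \<open>R - 1\<close>, then affine,
      reaching \<open>v R\<close> at \<open>R\<close>.\<close>
    let ?q = "\<lambda>r. k + (v R - k) * max 0 (r - (R - 1))"
    let ?p = "\<lambda>r. if r < R - 1 then 0 else v R - k"
    let ?h = "\<lambda>t. (v R - k)\<^sup>2 / 2 + G (k + (v R - k) * (root n t - (R - 1)))"
    have root_pow: "root n (r ^ n) = r" if "0 \<le> r" for r
      using that by (simp add: real_root_power_cancel)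
    have h_cont: "continuous_on X ?h" for X
      by (intro continuous_intros) auto
    have "integral {0..S} dens \<le> integral {0..s} (\<lambda>_. G k) + integral {s..S} ?h"
      unfolding S_def s_def
    proof (rule integral_dens_le[where q = ?q and p = ?p and L = "\<bar>v R - k\<bar>"])
      show "\<bar>v R - k\<bar>-lipschitz_on {0..R} ?q"
        by (intro lipschitz_onI) (auto simp: dist_real_def abs_mult simp flip: right_diff_distrib
            intro!: mult_left_mono)
      fix r :: real
      show "(?q has_real_derivative ?p r) (at r)" if "0 < r" "r < R" "r \<noteq> R - 1"
      proof (cases "r < R - 1")
        case True
        have "((\<lambda>_. k) has_real_derivative 0) (at r)" by simp
        then have "(?q has_real_derivative 0) (at r)"
          by (rule has_field_derivative_transform_within_open[where S="{..<R - 1}"]) (use True in auto)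
        then show ?thesis using True by simp
      next
        case False
        have "((\<lambda>r. k + (v R - k) * (r - (R - 1))) has_real_derivative v R - k) (at r)"
          by (auto intro!: derivative_eq_intros)
        then have "(?q has_real_derivative v R - k) (at r)"
          by (rule has_field_derivative_transform_within_open[where S="{R - 1<..}"])
            (use False that in auto)
        then show ?thesis using False by simp
      qed
    qed (use R1 h_cont root_pow in auto)
    also have "integral {0..s} (\<lambda>_. G k) = s * G k"
      using sS by simp
    also have "integral {s..S} ?h \<le> integral {s..S} (\<lambda>_. C)"
    proof (rule integral_le)
      fix t assume t: "t \<in> {s..S}"
      define \<theta> where "\<theta> = root n t - (R - 1)"
      have "root n s \<le> root n t" "root n t \<le> root n S"
        using t by auto
      then have th: "0 \<le> \<theta>" "\<theta> \<le> 1"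
        using R1 root_pow[of "R - 1"] root_pow[of R] by (auto simp: \<theta>_def s_def S_def)
      have "k + (v R - k) * \<theta> \<in> closed_segment k (v R)"
        using th by (auto simp: in_segment algebra_simps)
      also have "\<dots> \<subseteq> {-M..M}"
        using assms v_bound[of R] by (intro closed_segment_subset) (auto simp: abs_le_iff)
      finally have "\<bar>G (k + (v R - k) * \<theta>)\<bar> \<le> B"
        by (intro B) auto
      moreover have "(v R - k)\<^sup>2 \<le> (2 * M)\<^sup>2"
        using assms v_bound[of R] by (intro power2_le_iff_abs_le[THEN iffD2]) auto
      ultimately show "?h t \<le> C"
        unfolding C_def \<theta>_def by linarith
    qed (auto intro: integrable_continuous_interval h_cont)
    also have "\<dots> = (S - s) * C"
      using sS by simp
    finally have upper: "integral {0..S} dens \<le> s * G k + (S - s) * C"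
      by simp
    have "- (a * B) = integral {0..a} (\<lambda>_. - B)"
      using r1 by simp
    also have "\<dots> \<le> integral {0..a} dens"
    proof (rule integral_le)
      show "- B \<le> dens t" for t
        using B[OF v_bound[of "root n t"]] by (simp add: dens_def add_increasing)
    qed (auto intro: dens_integrable)
    finally have lower1: "- (a * B) \<le> integral {0..a} dens" .
    have "(S - a) * (G k + \<epsilon>) = integral {a..S} (\<lambda>_. G k + \<epsilon>)"
      using aS by simp
    also have "\<dots> \<le> integral {a..S} dens"
    proof (rule integral_le)
      fix t assume "t \<in> {a..S}"
      then have "root n a \<le> root n t" by simp
      then have "r\<^sub>0 \<le> root n t"
        using root_pow[OF r1(1)] unfolding a_def r\<^sub>1_def by linarith
      then show "G k + \<epsilon> \<le> dens t"
        using ge[of "root n t"] by (simp add: dens_def add_increasing)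
    qed (auto intro: dens_integrable)
    finally have "(S - a) * (G k + \<epsilon>) - a * B \<le> integral {0..S} dens"
      using lower1 Henstock_Kurzweil_Integration.integral_combine[OF r1(2) aS dens_integrable] by simp
    with upper show ?thesis
      unfolding S_def[symmetric] s_def[symmetric] by (simp add: algebra_simps)
  qed
  \<comment> \<open>The right side of \<open>main\<close> divided by \<open>R ^ n\<close>. The
    volume fraction of the layer, \<open>1 - (1 - inverse R) ^ n\<close>, tends to 0, so the limit
    contradicts the lower bound \<open>\<epsilon>\<close>.\<close>
  let ?f = "\<lambda>R::real. a * (G k + \<epsilon> + B) / R ^ n + (1 - (1 - inverse R) ^ n) * (C - G k)"
  have "(?f \<longlongrightarrow> 0 + (1 - (1 - 0) ^ n) * (C - G k)) at_top"
    by (intro tendsto_intros tendsto_divide_0[OF tendsto_const] tendsto_inverse_0_at_top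
        filterlim_at_top_imp_at_infinity filterlim_pow_at_top filterlim_ident) auto
  moreover have "\<forall>\<^sub>F R in at_top. \<epsilon> \<le> ?f R"
    using eventually_gt_at_top[of "1 + r\<^sub>1"]
  proof eventually_elim
    case (elim R)
    have R: "0 < R" using elim by (simp add: r\<^sub>1_def)
    have "(1 - inverse R) ^ n = (R - 1) ^ n / R ^ n"
      using R by (simp add: field_simps flip: power_divide)
    then have "?f R = (a * (G k + \<epsilon> + B) + (R ^ n - (R - 1) ^ n) * (C - G k)) / R ^ n"
      using R by (simp add: field_simps)
    then show ?case
      using main[OF elim] R by (simp add: pos_le_divide_eq)
  qed
  ultimately have "\<epsilon> \<le> 0 + (1 - (1 - 0) ^ n) * (C - G k)"
    by (intro tendsto_lowerbound) auto
  then show False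
    using \<open>0 < \<epsilon>\<close> by simp
qed

section \<open>Cutting out the core\<close>

text \<open>The competitor removes the core of volume \<^term>\<open>d\<close> from \<^term>\<open>u\<close>, shifts the rest inwards by a
  volume preserving map and fills the gap left at the boundary by the constant \<^term>\<open>v R\<close>. The
  potential energy of the shifted part is unchanged, and since \<open>\<rho>\<close> is nonexpanding its gradient energy
  does not increase.\<close>

lemma integral_core_le:
  assumes "0 < R" "0 < d" "d < R ^ n"
  shows "integral {0..d} dens \<le> d * G (v R)"
proof -
  \<comment> \<open>In the volume variable \<open>\<rho>\<close> is the translation by
    \<open>d\<close>, and \<open>\<rho>'\<close> is its derivative in \<open>r\<close>, which lies
    between 0 and 1. The radius \<open>s\<close> is the one that \<open>\<rho>\<close> maps to
    \<open>R\<close>.\<close>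
  define \<rho> where "\<rho> = (\<lambda>r::real. root n (r ^ n + d))"
  define \<rho>' where "\<rho>' = (\<lambda>r. (r / \<rho> r) ^ (n - 1))"
  define s where "s = root n (R ^ n - d)"
  \<comment> \<open>The cap at \<open>R\<close> produces the constant \<open>v R\<close> on the
    outer shell from \<open>s\<close> to \<open>R\<close>.\<close>
  define q where "q = (\<lambda>r. v (min R (\<rho> r)))"
  have n: "0 < n" by simp
  have s_pow: "s ^ n = R ^ n - d"
    using assms by (simp add: s_def)
  have "s < root n (R ^ n)"
    unfolding s_def using assms by (intro real_root_less_mono) auto
  then have s: "0 < s" "s < R"
    using assms by (auto simp: s_def real_root_power_cancel)
  have \<rho>_pos: "0 < \<rho> r" and \<rho>_ge: "r \<le> \<rho> r" if "0 \<le> r" for r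
  proof -
    have "0 \<le> r ^ n" using that by simp
    then show "0 < \<rho> r" using assms by (simp add: \<rho>_def add_nonneg_pos)
    have "root n (r ^ n) \<le> \<rho> r"
      unfolding \<rho>_def using assms by (intro real_root_le_mono) auto
    then show "r \<le> \<rho> r"
      using that by (simp add: real_root_power_cancel)
  qed
  have \<rho>'_bound: "0 \<le> \<rho>' r" "\<rho>' r \<le> 1" if "0 \<le> r" for r
    using that \<rho>_pos[OF that] \<rho>_ge[OF that] by (auto simp: \<rho>'_def intro!: power_le_one)
  have \<rho>_deriv: "(\<rho> has_real_derivative \<rho>' r) (at r)" if "0 \<le> r" for r
  proof -
    have pos: "0 < r ^ n + d" using that assms by (simp add: add_nonneg_pos)
    have "(\<rho> has_real_derivative
        inverse (real n * root n (r ^ n + d) ^ (n - Suc 0)) * (real n * r ^ (n - Suc 0))) (at r)"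
      unfolding \<rho>_def
      by (rule DERIV_chain2[where f = "root n" and g = "\<lambda>r. r ^ n + d", OF DERIV_real_root[OF n pos]])
        (auto intro!: derivative_eq_intros)
    also have "inverse (real n * root n (r ^ n + d) ^ (n - Suc 0)) * (real n * r ^ (n - Suc 0)) = \<rho>' r"
      using n by (simp add: \<rho>'_def \<rho>_def power_divide field_simps)
    finally show ?thesis .
  qed
  have \<rho>_lip: "1-lipschitz_on {0..} \<rho>"
  proof (rule bounded_derivative_imp_lipschitz)
    show "(\<rho> has_derivative (*) (\<rho>' r)) (at r within {0..})" if "r \<in> {0..}" for r
      using \<rho>_deriv[of r] that by (auto simp: has_field_derivative_def intro: has_derivative_at_withinI)
    show "onorm ((*) (\<rho>' r)) \<le> 1" if "r \<in> {0..}" for r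
      using \<rho>'_bound[of r] that
      by (intro onorm_bound) (auto simp: abs_mult intro!: mult_left_le_one_le)
  qed auto
  have \<rho>_less_iff: "\<rho> r < R \<longleftrightarrow> r < s" if "0 \<le> r" for r
  proof -
    have "\<rho> r < R \<longleftrightarrow> \<rho> r < root n (R ^ n)"
      using assms by (simp add: real_root_power_cancel)
    also have "\<dots> \<longleftrightarrow> r ^ n < s ^ n"
      using n by (auto simp: \<rho>_def s_pow)
    also have "\<dots> \<longleftrightarrow> r < s"
      using that s n by (intro power_mono_iff[THEN arg_cong[where f=Not], of s r n, simplified not_le]) auto
    finally show ?thesis .
  qed
  obtain K where K: "\<bar>v' r\<bar> \<le> K" if "r \<in> {0..R}" for r
    using compact_imp_bounded[OF compact_continuous_image[OF continuous_on_subset[OF v'_cont] compact_Icc[of 0 R]]]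
    by (fastforce simp: bounded_iff)
  have "0 \<le> K" using K[of 0] assms by simp
  have v_lip: "K-lipschitz_on {0..R} v"
  proof (rule bounded_derivative_imp_lipschitz)
    show "(v has_derivative (*) (v' r)) (at r within {0..R})" for r
      using v[of r] by (auto simp: has_field_derivative_def intro: has_derivative_at_withinI)
    show "onorm ((*) (v' r)) \<le> K" if "r \<in> {0..R}" for r
      using K[OF that] \<open>0 \<le> K\<close>
      by (intro onorm_bound) (auto simp: abs_mult intro!: mult_right_mono)
  qed (use \<open>0 \<le> K\<close> in auto)
  \<comment> \<open>The cap keeps the argument inside \<open>{0..R}\<close>, where \<open>v\<close>
    is known to be Lipschitz with constant \<open>K\<close>.\<close>
  have "1-lipschitz_on {0..R} (\<lambda>r. min R (\<rho> r))"
  proof (rule lipschitz_onI)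
    fix x y assume "x \<in> {0..R}" "y \<in> {0..R}"
    then have "dist (\<rho> x) (\<rho> y) \<le> 1 * dist x y"
      by (intro lipschitz_onD[OF \<rho>_lip]) auto
    then show "dist (min R (\<rho> x)) (min R (\<rho> y)) \<le> 1 * dist x y"
      unfolding dist_real_def by linarith
  qed simp
  moreover have "(\<lambda>r. min R (\<rho> r)) ` {0..R} \<subseteq> {0..R}"
    using \<rho>_pos assms by (auto simp: less_imp_le)
  ultimately have q_lip: "(K * 1)-lipschitz_on {0..R} q"
    unfolding q_def by (intro lipschitz_on_compose2 lipschitz_on_subset[OF v_lip]) auto
  let ?p = "\<lambda>r. if r < s then v' (\<rho> r) * \<rho>' r else 0"
  \<comment> \<open>With \<open>t = r ^ n\<close>, the radius \<open>\<rho> r\<close> is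
    \<open>root n (t + d)\<close> and the power of the quotient of roots is
    \<open>\<rho>' r\<close>.\<close>
  let ?h = "\<lambda>t. (v' (root n (t + d)) * (root n t / root n (t + d)) ^ (n - 1))\<^sup>2 / 2
    + G (v (root n (t + d)))"
  have h_cont: "continuous_on {0..s ^ n} ?h"
    using assms by (intro continuous_intros) (auto simp: add_nonneg_pos)
  have "integral {0..R ^ n} dens \<le> integral {0..s ^ n} ?h + integral {s ^ n..R ^ n} (\<lambda>_. G (v R))"
  proof (rule integral_dens_le[where q = q and p = ?p, OF _ _ q_lip])
    show "q R = v R"
      using \<rho>_ge[of R] assms by (simp add: q_def min_def)
    fix r :: real
    show "(q has_real_derivative ?p r) (at r)" if r: "0 < r" "r < R" "r \<noteq> s"
    proof (cases "r < s")
      case True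
      have "((\<lambda>r. v (\<rho> r)) has_real_derivative v' (\<rho> r) * \<rho>' r) (at r)"
        using \<rho>_deriv[of r] r by (intro DERIV_chain2[OF v]) auto
      then have "(q has_real_derivative v' (\<rho> r) * \<rho>' r) (at r)"
      proof (rule has_field_derivative_transform_within_open[where S="{0<..<s}"])
        fix x assume "x \<in> {0<..<s}"
        then show "v (\<rho> x) = q x" using \<rho>_less_iff[of x] by (simp add: q_def)
      qed (use True r in auto)
      then show ?thesis using True by simp
    next
      case False
      have "((\<lambda>_. v R) has_real_derivative 0) (at r)" by simp
      then have "(q has_real_derivative 0) (at r)"
      proof (rule has_field_derivative_transform_within_open[where S="{s<..}"])
        fix x assume "x \<in> {s<..}"
        then show "v R = q x" using \<rho>_less_iff[of x] s by (simp add: q_def min_def)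
      qed (use False r in auto)
      then show ?thesis using False by simp
    qed
    show "?h (r ^ n) = (?p r)\<^sup>2 / 2 + G (q r)" if "0 < r" "r < s"
      using that \<rho>_less_iff[of r]
      by (simp add: q_def \<rho>'_def \<rho>_def real_root_power_cancel)
    show "G (v R) = (?p r)\<^sup>2 / 2 + G (q r)" if "s < r" "r < R"
      using that \<rho>_less_iff[of r] s by (simp add: q_def min_def)
  qed (use s h_cont in auto)
  also have "integral {s ^ n..R ^ n} (\<lambda>_. G (v R)) = d * G (v R)"
    using assms by (simp add: s_pow)
  \<comment> \<open>The potential terms agree; the gradient term only loses the factor
    \<open>c ^ (n - 1)\<close>, which is at most 1.\<close>
  also have "integral {0..s ^ n} ?h \<le> integral {0..s ^ n} (\<lambda>t. dens (t + d))"
  proof (rule integral_le)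
    fix t assume t: "t \<in> {0..s ^ n}"
    define c where "c = root n t / root n (t + d)"
    have "root n t \<le> root n (t + d)" "0 \<le> root n t"
      using t assms by auto
    then have "0 \<le> c" "c \<le> 1"
      by (auto simp: c_def divide_le_eq_1)
    then have "\<bar>v' (root n (t + d)) * c ^ (n - 1)\<bar> \<le> \<bar>v' (root n (t + d))\<bar>"
      by (simp add: abs_mult mult_left_le power_le_one)
    then have "(v' (root n (t + d)) * c ^ (n - 1))\<^sup>2 \<le> (v' (root n (t + d)))\<^sup>2"
      by (simp add: abs_le_square_iff)
    then show "?h t \<le> dens (t + d)"
      unfolding dens_def c_def by simp
  next
    show "(\<lambda>t. dens (t + d)) integrable_on {0..s ^ n}"
      by (intro integrable_continuous_interval continuous_on_compose2[OF dens_cont[of UNIV]]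
          continuous_intros) auto
  qed (rule integrable_continuous_interval[OF h_cont])
  also have "integral {0..s ^ n} (\<lambda>t. dens (t + d)) = integral {d..R ^ n} dens"
    using integral_shift_real_ivl[of d d "R ^ n" dens] by (simp add: s_pow)
  \<comment> \<open>The energy over \<open>{d..R ^ n}\<close> now stands on both sides and cancels,
    leaving the core on the left and the filled shell on the right.\<close>
  finally show ?thesis
    using Henstock_Kurzweil_Integration.integral_combine[of 0 d "R ^ n" dens] dens_integrable assms by simp
qed

section \<open>Vanishing of the gradient\<close>

text \<open>Let \<open>G (v p)\<close> be the minimum of the potential over the core. The two
  preceding lemmas bound the core energy by \<open>d * G (v p)\<close>, while \<open>dens\<close> is
  at least \<open>G (v p)\<close> there. Equality and continuity force \<open>dens = G (v p)\<close>
  pointwise, which leaves no room for the term \<open>(v' r)\<^sup>2 / 2\<close>.\<close>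

lemma deriv_eq_0:
  assumes "0 < r"
  shows "v' r = 0"
proof -
  define d where "d = (r + 1) ^ n"
  have d: "0 < d" using assms by (simp add: d_def)
  have r_d: "r ^ n \<in> {0..d}"
    using assms unfolding d_def by (auto intro: power_mono)
  have "continuous_on {0..r + 1} (\<lambda>r. G (v r))"
    by (intro continuous_intros)
  then obtain p where p: "p \<in> {0..r + 1}" "G (v p) \<le> G (v y)" if "y \<in> {0..r + 1}" for y
    using continuous_attains_inf[of "{0..r + 1}" "\<lambda>r. G (v r)"] assms by auto
  have eps: "integral {0..d} dens \<le> d * (G (v p) + \<epsilon>)" if \<epsilon>: "0 < \<epsilon>" for \<epsilon>
  proof -
    \<comment> \<open>Dips of the potential occur at arbitrarily large radii; demanding
      \<open>r + 2 \<le> R\<close> puts the whole core strictly inside the ball of radius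
      \<open>R\<close>.\<close>
    obtain R where R: "r + 2 \<le> R" "G (v R) < G (v p) + \<epsilon>"
      using potential_dips[OF \<epsilon> v_bound[of p], of "r + 2"] by blast
    have "d < R ^ n"
      unfolding d_def using R assms by (intro power_strict_mono) auto
    then have "integral {0..d} dens \<le> d * G (v R)"
      using R assms d by (intro integral_core_le) auto
    also have "\<dots> \<le> d * (G (v p) + \<epsilon>)"
      using R d by simp
    finally show ?thesis .
  qed
  have le: "integral {0..d} dens \<le> d * G (v p)"
  proof (rule field_le_epsilon)
    fix e :: real assume "0 < e"
    then show "integral {0..d} dens \<le> d * G (v p) + e"
      using eps[of "e / d"] d by (simp add: distrib_left)
  qed
  have cont: "continuous_on {0..d} (\<lambda>t. dens t - G (v p))"
    by (intro continuous_intros dens_cont)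
  have nonneg: "0 \<le> dens t - G (v p)" if "t \<in> {0..d}" for t
  proof -
    have "root n t \<le> root n d" using that by simp
    then have "root n t \<in> {0..r + 1}"
      using that assms by (simp add: d_def real_root_power_cancel)
    then show ?thesis
      using p(2) by (simp add: dens_def add_increasing)
  qed
  have "integral {0..d} (\<lambda>t. dens t - G (v p)) = integral {0..d} dens - d * G (v p)"
    using d by (subst integral_diff) (auto intro: dens_integrable)
  moreover have "0 \<le> integral {0..d} (\<lambda>t. dens t - G (v p))"
    using nonneg by (intro integral_nonneg integrable_diff dens_integrable) auto
  ultimately have "integral {0..d} (\<lambda>t. dens t - G (v p)) = 0"
    using le by simp
  then have "dens (r ^ n) - G (v p) = 0"
    using integral_eq_0_iff[of 0 d "\<lambda>t. dens t - G (v p)"] cont nonneg d r_d by blast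
  moreover have "G (v p) \<le> G (v r)"
    using p(2) assms by simp
  moreover have "dens (r ^ n) = (v' r)\<^sup>2 / 2 + G (v r)"
    using assms by (simp add: dens_def real_root_power_cancel)
  ultimately have "(v' r)\<^sup>2 \<le> 0" by linarith
  then show ?thesis by simp
qed

lemma u_constant: "u constant_on UNIV"
proof -
  have "v r = v 0" if "0 \<le> r" for r
  proof (cases "r = 0")
    case False
    show ?thesis
    proof (rule DERIV_isconst_end[OF _ v_cont])
      show "(v has_real_derivative 0) (at x)" if "0 < x" for x
        using v[of x] deriv_eq_0[OF that] by simp
    qed (use that False in auto)
  qed simp
  then show ?thesis
    unfolding constant_on_def u using norm_ge_zero by blast
qed

end


section \<open>From global minimizers to profiles\<close>

lemma global_minimizer_radial_constant:
  fixes u :: "'a::euclidean_space \<Rightarrow> real"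
  assumes "global_minimizer f u" "bounded (range u)" "radial u"
  shows "u constant_on UNIV"
proof -
  obtain e :: 'a where e: "e \<in> Basis"
    using nonempty_Basis by blast
  \<comment> \<open>Since \<open>e\<close> is a unit vector, \<open>norm x *\<^sub>R e\<close> has
    the norm of \<open>x\<close>, and radiality gives \<open>u x = v (norm x)\<close>. The
    derivative of \<open>v\<close> is the directional derivative of \<open>u\<close> along
    \<open>e\<close>.\<close>
  define v where "v = (\<lambda>r. u (r *\<^sub>R e))"
  define v' where "v' = (\<lambda>r. frechet_derivative u (at (r *\<^sub>R e)) e)"
  obtain G where G: "\<And>t. (G has_real_derivative - f t) (at t)"
    and min: "\<And>\<Omega> w L. smooth_bounded_domain \<Omega> \<Longrightarrow> L-lipschitz_on (closure \<Omega>) w \<Longrightarrow>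
      (\<forall>x\<in>frontier \<Omega>. w x = u x) \<Longrightarrow> energy G \<Omega> u \<le> energy G \<Omega> w"
    using assms(1) unfolding global_minimizer_def by blast
  have C1: "u differentiable (at x)"
    "continuous_on UNIV (\<lambda>x. frechet_derivative u (at x) e)" for x
    using assms(1) e by (auto simp: global_minimizer_def)
  obtain M where M: "\<bar>u x\<bar> \<le> M" for x
    using assms(2) by (auto simp: bounded_iff)
  interpret radial_minimizer u v v' G M "DIM('a)"
  proof
    show "u = (\<lambda>x. v (norm x))"
    proof
      fix x :: 'a
      have "norm x = norm (norm x *\<^sub>R e)" using e by simp
      then show "u x = v (norm x)"
        using assms(3) unfolding radial_def v_def by blast
    qed
    show "(v has_real_derivative v' r) (at r)" for r
    proof -
      have u': "(u has_derivative frechet_derivative u (at (r *\<^sub>R e))) (at (r *\<^sub>R e))"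
        using C1(1) by (simp add: frechet_derivative_works)
      have "((\<lambda>r. r *\<^sub>R e) has_derivative (\<lambda>h. h *\<^sub>R e)) (at r)"
        by (auto intro!: derivative_eq_intros)
      from has_derivative_compose[OF this u']
      have "(v has_derivative (\<lambda>h. frechet_derivative u (at (r *\<^sub>R e)) (h *\<^sub>R e))) (at r)"
        by (simp add: v_def)
      moreover have "frechet_derivative u (at (r *\<^sub>R e)) (h *\<^sub>R e) = v' r * h" for h
        using has_derivative_linear[OF u'] by (simp add: v'_def linear_cmul)
      ultimately show ?thesis
        by (simp add: has_field_derivative_def)
    qed
    show "continuous_on UNIV v'"
      unfolding v'_def by (intro continuous_on_compose2[OF C1(2)] continuous_intros) auto
    show "continuous_on UNIV G"
      using G by (meson DERIV_isCont continuous_at_imp_continuous_on)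
    show "\<bar>v r\<bar> \<le> M" for r
      using M by (simp add: v_def)
    show "energy G (ball 0 R) u \<le> energy G (ball 0 R) w"
      if "0 < R" "L-lipschitz_on (cball 0 R) w" "\<And>x. norm x = R \<Longrightarrow> w x = u x" for R L w
      using that by (intro min smooth_bounded_domain_ball) (auto simp: frontier_ball)
  qed simp
  show ?thesis by (rule u_constant)
qed

theorem corollary1p3:
  fixes f :: "real \<Rightarrow> real"
  assumes "f C1_differentiable_on UNIV"
  shows "\<not> (\<exists>u :: real ^ 'n \<Rightarrow> real.
           global_minimizer f u \<and> bounded (range u) \<and> radial u \<and> \<not> u constant_on UNIV)"
  using global_minimizer_radial_constant by blast

end
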